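(* Let $N=\{1,\dots,n\}$ be the set of buyers and $M=\{1,\dots,n\}$ the set of goods (equal number of buyers and goods). Suppose there are differentiable functions $w_i,f_i:\mathbb R\to\mathbb R$ $(i\in N)$, with every $w_i$ strictly increasing, such that: (1) each buyer's valuation of a nonempty set of goods equals the valuation of the highest-valued good in the set: $v_{i,S}=\max_{K\in S}v_{i,K}$; (2) $v_{i,K}(s_{1K},\dots,s_{nK})=w_i(s_{iK})+\sum_{j\ne i}f_j(s_{jK})$ for all $i\in N$, $K\in M$ and all $(s_{1K},\dots,s_{nK})$; (3) $w_i'(x)>f_i'(x)$ for all $x\in\mathbb R$ and $i\in N$; (4) for every $i\in N$ there exist constants $c_i,d_i\in\mathbb R$ with $w_i(x)=c_if_i(x)+d_i$ for all $x\in\mathbb R$; (5) all valuations are nonnegative at the buyers' true signals: $v_{i,K}(s_{1K},\dots,s_{nK})\ge 0$ for all $i\in N,K\in M$. Then truthful bidding (each buyer $i$ submits his or her true signal vector $(s_{i1},\dots,s_{in})$) is a Nash equilibrium of Auction 1 (defined in the context).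
   Context: Buyer $i$ privately observes one real signal $s_{iK}\in\mathcal S_{iK}\subseteq\mathbb R$ for each good $K$; $v_{i,K}$ is a function of $s_K=(s_{1K},\dots,s_{nK})$. The valuation functions are common knowledge and known to the auction designer. A buyer who receives a set $S$ of goods and pays $P$ has utility $v_{i,S}-P$ (valuation evaluated at the true signals); with random tie-breaking, utilities are expected utilities. The welfare of an allocation is the sum over buyers of their valuations of the sets they receive. $P_n$ denotes the set of permutations of $\{1,\dots,n\}$; $\sigma\in P_n$ defines the allocation $S_\sigma$ in which buyer $i$ receives exactly the good $\sigma(i)$, with welfare $W(S_\sigma)=\sum_{j\in N}v_{j,\sigma(j)}(s_{\sigma(j)})$. Auction 1: (Bidding) Each buyer $i$ submits a vector $(s_{i1},\dots,s_{in})\in\mathbb R^n$. In the allocation and payment rules below, all valuations and welfares are computed from the submitted vectors, as if they were the true signals. (Allocation) Let $\sigma^*\in P_n$ maximize $W(S_\sigma)$ over $\sigma \in P_n$ (if there are several maximizers, one is selected uniformly at random). Buyer $i$ receives good $\sigma^*(i)$. (Payment) For $\sigma\in P_n$ put $$P_i(\sigma)=\frac{w_i'(0)}{w_i'(0)-f_i'(0)}\,W(S_\sigma)-v_{i,\sigma(i)}(s_{\sigma(i)})-\frac{w_i'(0)}{w_i'(0)-f_i'(0)}\sum_{K\in M}f_i(s_{iK}).$$ Buyer $i$ pays $\max_{\sigma\in P_n}P_i(\sigma)-P_i(\sigma^* )$. Nash equilibrium (of pure strategies, a strategy mapping a buyer's own signals to a bid): at every profile of true signals satisfying the hypotheses,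 for every buyer $i$, if all other buyers follow their prescribed strategies, then no bid of buyer $i$ gives buyer $i$ a strictly higher utility than the prescribed one. *)

theory Defs
  imports "HOL-Analysis.Analysis" "HOL-Probability.Probability_Mass_Function"
begin

text \<open>
  The finite type \<open>'n\<close> indexes both the buyers and the goods, so their numbers agree. A signal or bid
  profile is a matrix \<open>s\<close> with \<open>s $ i $ K\<close> the signal of buyer \<open>i\<close> for good \<open>K\<close>: the row \<open>s $ i\<close> is
  what buyer \<open>i\<close> observes (or submits), and \<open>column K s\<close> is the tuple of all buyers' signals for
  good \<open>K\<close>.

  \<open>v i K\<close> is buyer \<open>i\<close>'s valuation of the single good \<open>K\<close>, a function of \<open>column K s\<close>, and
  \<open>V i S\<close> is the valuation of the set \<open>S\<close> of goods, a function of the whole profile \<open>s\<close>.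
\<close>

type_synonym 'n profile = "real ^ 'n ^ 'n"
type_synonym 'n good_valuation = "'n \<Rightarrow> 'n \<Rightarrow> real ^ 'n \<Rightarrow> real"
type_synonym 'n set_valuation = "'n \<Rightarrow> 'n set \<Rightarrow> 'n profile \<Rightarrow> real"

definition welfare :: "('n::finite) set_valuation \<Rightarrow> ('n \<Rightarrow> 'n set) \<Rightarrow> 'n profile \<Rightarrow> real" where
  "welfare V A s = (\<Sum>i\<in>UNIV. V i (A i) s)"

definition perm_alloc :: "('n \<Rightarrow> 'n) \<Rightarrow> 'n \<Rightarrow> 'n set" where
  "perm_alloc \<sigma> i = {\<sigma> i}"

definition welfare_maximizers :: "('n::finite) set_valuation \<Rightarrow> 'n profile \<Rightarrow> ('n \<Rightarrow> 'n) set" where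
  "welfare_maximizers V b =
     {\<sigma>. \<sigma> permutes UNIV \<and>
         (\<forall>\<tau>. \<tau> permutes UNIV \<longrightarrow> welfare V (perm_alloc \<tau>) b \<le> welfare V (perm_alloc \<sigma>) b)}"

definition pay_term ::
  "('n::finite \<Rightarrow> real \<Rightarrow> real) \<Rightarrow> ('n \<Rightarrow> real \<Rightarrow> real) \<Rightarrow> 'n good_valuation \<Rightarrow> 'n set_valuation \<Rightarrow>
   'n profile \<Rightarrow> 'n \<Rightarrow> ('n \<Rightarrow> 'n) \<Rightarrow> real" where
  "pay_term w f v V b i \<sigma> =
     deriv (w i) 0 / (deriv (w i) 0 - deriv (f i) 0) * welfare V (perm_alloc \<sigma>) b
     - v i (\<sigma> i) (column (\<sigma> i) b)
     - deriv (w i) 0 / (deriv (w i) 0 - deriv (f i) 0) * (\<Sum>K\<in>UNIV. f i (b $ i $ K))"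

definition payment ::
  "('n::finite \<Rightarrow> real \<Rightarrow> real) \<Rightarrow> ('n \<Rightarrow> real \<Rightarrow> real) \<Rightarrow> 'n good_valuation \<Rightarrow> 'n set_valuation \<Rightarrow>
   'n profile \<Rightarrow> 'n \<Rightarrow> ('n \<Rightarrow> 'n) \<Rightarrow> real" where
  "payment w f v V b i \<sigma> =
     Max (pay_term w f v V b i ` {\<tau>. \<tau> permutes UNIV}) - pay_term w f v V b i \<sigma>"

text \<open>
  Expected utility (over the uniform tie-breaking) of buyer \<open>i\<close> at true signals \<open>s\<close> and submitted bids \<open>b\<close>. The
  received set is valued at \<open>s\<close>; the allocation and the payment depend on \<open>b\<close> only.
\<close>

definition auction1_utility ::
  "('n::finite \<Rightarrow> real \<Rightarrow> real) \<Rightarrow> ('n \<Rightarrow> real \<Rightarrow> real) \<Rightarrow> 'n good_valuation \<Rightarrow> 'n set_valuation \<Rightarrow>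
   'n profile \<Rightarrow> 'n profile \<Rightarrow> 'n \<Rightarrow> real" where
  "auction1_utility w f v V s b i =
     measure_pmf.expectation (pmf_of_set (welfare_maximizers V b))
       (\<lambda>\<sigma>. V i (perm_alloc \<sigma> i) s - payment w f v V b i \<sigma>)"

text \<open>
  \<open>U s b i\<close> is the utility of buyer \<open>i\<close> at true signals \<open>s\<close> and bids \<open>b\<close>, and \<open>T\<close> is the set of
  admissible profiles of true signals. The condition is required at every profile in \<open>T\<close>
  separately, without averaging over the other buyers' signals.
\<close>

definition nash_equilibrium ::
  "('n profile \<Rightarrow> 'n profile \<Rightarrow> 'n::finite \<Rightarrow> real) \<Rightarrow> 'n profile set \<Rightarrow>
   ('n \<Rightarrow> real ^ 'n \<Rightarrow> real ^ 'n) \<Rightarrow> bool" where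
  "nash_equilibrium U T \<beta> \<longleftrightarrow>
     (\<forall>s\<in>T. \<forall>i. \<forall>x. U s (\<chi> j. if j = i then x else \<beta> j (s $ j)) i \<le> U s (\<chi> j. \<beta> j (s $ j)) i)"

definition truthful :: "'n \<Rightarrow> real ^ 'n \<Rightarrow> real ^ 'n" where
  "truthful i x = x"

end

theory Submission
  imports Defs
begin

text \<open>
  Because \<open>w i\<close> is an affine function of \<open>f i\<close>, the weight \<open>r = w i' / (w i' - f i')\<close> is a positive
  constant and \<open>r * (w i - f i)\<close> differs from \<open>w i\<close> only by a constant. This makes buyer \<open>i\<close>'s payment
  terms independent of buyer \<open>i\<close>'s own bid. When the others are truthful, buyer \<open>i\<close>'s utility from
  an allocation is therefore \<open>r\<close> times its true welfare, up to a constant that no bid of \<open>i\<close> can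
  change, and a truthful bid makes the auction select an allocation that maximizes it.
\<close>

text \<open>Differentiating the affine relation at \<open>x0\<close> turns \<open>r\<close> into
  \<open>c / (c - 1)\<close>, in which \<open>x0\<close> no longer occurs. Since
  \<open>w x - f x\<close> equals \<open>(c - 1) * f x + d\<close>, the factor \<open>r\<close>
  restores the slope \<open>c\<close> at every \<open>x\<close>, not only at
  \<open>x0\<close>.\<close>

lemma affine_deriv_ratio:
  fixes w f :: "real \<Rightarrow> real"
  assumes "f differentiable (at x0)"
    and "strict_mono w"
    and "deriv f x0 < deriv w x0"
    and affine: "\<And>x. w x = c * f x + d"
  defines "r \<equiv> deriv w x0 / (deriv w x0 - deriv f x0)"
  shows "r > 0" and "\<exists>e. \<forall>x. r * (w x - f x) = w x + e"
proof -
  have df: "(f has_real_derivative deriv f x0) (at x0)"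
    using assms(1) by (simp add: DERIV_deriv_iff_real_differentiable)
  have "w = (\<lambda>x. c * f x + d)"
    using affine by blast
  then have dw: "(w has_real_derivative c * deriv f x0) (at x0)"
    by (auto intro!: derivative_eq_intros df)
  then have dw_eq: "deriv w x0 = c * deriv f x0"
    by (rule DERIV_imp_deriv)
  have "deriv w x0 \<ge> 0"
    using dw dw_eq \<open>strict_mono w\<close>
    by (metis mono_on_imp_deriv_nonneg UNIV_I interior_UNIV strict_mono_mono)
  \<comment> \<open>Strict monotonicity alone allows a zero derivative. With
    \<open>c \<noteq> 0\<close>, a zero derivative of \<open>w\<close> would force one of
    \<open>f\<close>, against the strict inequality between them.\<close>
  moreover have "c \<noteq> 0"
    using \<open>strict_mono w\<close> affine strict_monoD[of w 0 1] by force
  ultimately have "deriv w x0 > 0"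
    using dw_eq assms(3) by (metis less_eq_real_def mult_eq_0_iff)
  then show "r > 0"
    using assms(3) by (simp add: r_def)
  have "deriv f x0 \<noteq> 0" "c \<noteq> 1"
    using \<open>deriv w x0 > 0\<close> dw_eq assms(3) by auto
  have "deriv w x0 - deriv f x0 = (c - 1) * deriv f x0"
    by (simp add: dw_eq algebra_simps)
  then have "r = c / (c - 1)"
    using \<open>deriv f x0 \<noteq> 0\<close> dw_eq by (simp add: r_def)
  then have "r * (c - 1) = c"
    using \<open>c \<noteq> 1\<close> by simp
  then have "r * (w x - f x) = w x + (r * d - d)" for x
  proof -
    have "r * (w x - f x) = r * (c - 1) * f x + r * d"
      by (simp add: affine algebra_simps)
    then show ?thesis
      using \<open>r * (c - 1) = c\<close> affine by simp
  qed
  then show "\<exists>e. \<forall>x. r * (w x - f x) = w x + e"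
    by blast
qed

text \<open>All buyers share the sum of every \<open>f l\<close> for a good, and buyer
  \<open>j\<close> adds only the correction \<open>w j - f j\<close> at the own signal. A new row
  \<open>i\<close> shifts the shared sum equally for everyone and the correction of buyer
  \<open>i\<close> alone.\<close>

lemma good_valuation_diff_own_row:
  fixes w f :: "'n::finite \<Rightarrow> real \<Rightarrow> real"
  assumes v: "\<And>i K y. v i K y = w i (y $ i) + (\<Sum>j\<in>UNIV - {i}. f j (y $ j))"
    and others: "\<And>j. j \<noteq> i \<Longrightarrow> b $ j = s $ j"
  shows "v j K (column K b) - v j K (column K s) =
    f i (b $ i $ K) - f i (s $ i $ K) +
    (if j = i then (w i (b $ i $ K) - f i (b $ i $ K)) - (w i (s $ i $ K) - f i (s $ i $ K)) else 0)"
proof -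
  have v': "v j K y = (w j (y $ j) - f j (y $ j)) + (\<Sum>l\<in>UNIV. f l (y $ l))" for y
    by (simp add: v sum_diff1)
  have "(\<Sum>l\<in>UNIV. f l (column K b $ l)) - (\<Sum>l\<in>UNIV. f l (column K s $ l)) =
      (\<Sum>l\<in>UNIV. if l = i then f i (b $ i $ K) - f i (s $ i $ K) else 0)"
    unfolding sum_subtractf[symmetric]
    by (rule sum.cong) (auto simp: column_def others)
  then have "(\<Sum>l\<in>UNIV. f l (column K b $ l)) - (\<Sum>l\<in>UNIV. f l (column K s $ l)) =
      f i (b $ i $ K) - f i (s $ i $ K)"
    by simp
  then show ?thesis
    unfolding v' by (auto simp: column_def others)
qed

text \<open>A permutation assigns each good exactly once, so the shared shifts add up to a total
  over all goods that is the same for every \<open>\<sigma>\<close>. Only the correction at the good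
  \<open>\<sigma> i\<close> depends on the allocation.\<close>

lemma welfare_perm_alloc_diff_own_row:
  fixes w f :: "'n::finite \<Rightarrow> real \<Rightarrow> real"
  assumes V: "\<And>i K s. V i {K} s = v i K (column K s)"
    and v: "\<And>i K y. v i K y = w i (y $ i) + (\<Sum>j\<in>UNIV - {i}. f j (y $ j))"
    and others: "\<And>j. j \<noteq> i \<Longrightarrow> b $ j = s $ j"
    and "\<sigma> permutes UNIV"
  shows "welfare V (perm_alloc \<sigma>) b - welfare V (perm_alloc \<sigma>) s =
    (\<Sum>K\<in>UNIV. f i (b $ i $ K)) - (\<Sum>K\<in>UNIV. f i (s $ i $ K)) +
    ((w i (b $ i $ \<sigma> i) - f i (b $ i $ \<sigma> i)) - (w i (s $ i $ \<sigma> i) - f i (s $ i $ \<sigma> i)))"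
proof -
  have "(\<Sum>j\<in>UNIV. f i (b $ i $ \<sigma> j) - f i (s $ i $ \<sigma> j)) =
      (\<Sum>K\<in>UNIV. f i (b $ i $ K) - f i (s $ i $ K))"
    using sum.permute[OF \<open>\<sigma> permutes UNIV\<close>, of "\<lambda>K. f i (b $ i $ K) - f i (s $ i $ K)"]
    by (simp add: o_def)
  then show ?thesis
    unfolding welfare_def perm_alloc_def V sum_subtractf[symmetric]
    by (simp add: good_valuation_diff_own_row[of v w f i b s, OF v others] sum.distrib
        del: sum_subtractf)
qed

lemma pay_term_own_row_irrelevant:
  fixes w f :: "'n::finite \<Rightarrow> real \<Rightarrow> real"
  assumes V: "\<And>i K s. V i {K} s = v i K (column K s)"
    and v: "\<And>i K y. v i K y = w i (y $ i) + (\<Sum>j\<in>UNIV - {i}. f j (y $ j))"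
    and others: "\<And>j. j \<noteq> i \<Longrightarrow> b $ j = s $ j"
    and ratio: "\<And>x. deriv (w i) 0 / (deriv (w i) 0 - deriv (f i) 0) * (w i x - f i x) = w i x + e"
    and "\<sigma> permutes UNIV"
  shows "pay_term w f v V b i \<sigma> = pay_term w f v V s i \<sigma>"
proof -
  define r where "r = deriv (w i) 0 / (deriv (w i) 0 - deriv (f i) 0)"
  define F where "F t = (\<Sum>K\<in>UNIV. f i (t $ i $ K))" for t :: "'n profile"
  define D where "D t = w i (t $ i $ \<sigma> i) - f i (t $ i $ \<sigma> i)" for t :: "'n profile"
  \<comment> \<open>Subtracting \<open>F\<close>, as the last summand of \<open>pay_term\<close>
    does, removes the part of the change common to all permutations. By \<open>ratio\<close>,
    \<open>r\<close> times the rest is the change in the buyer's own valuation, which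
    \<open>pay_term\<close> also subtracts.\<close>
  have "(welfare V (perm_alloc \<sigma>) b - F b) - (welfare V (perm_alloc \<sigma>) s - F s) = D b - D s"
    using welfare_perm_alloc_diff_own_row[of V v w f i b s \<sigma>, OF V v others \<open>\<sigma> permutes UNIV\<close>]
    unfolding F_def D_def by simp
  then have "r * (welfare V (perm_alloc \<sigma>) b - F b) - r * (welfare V (perm_alloc \<sigma>) s - F s) =
      r * D b - r * D s"
    by (metis right_diff_distrib)
  also have "\<dots> = w i (b $ i $ \<sigma> i) - w i (s $ i $ \<sigma> i)"
    using ratio by (simp add: r_def D_def)
  also have "\<dots> = v i (\<sigma> i) (column (\<sigma> i) b) - v i (\<sigma> i) (column (\<sigma> i) s)"
    by (simp add: good_valuation_diff_own_row[of v w f i b s, OF v others])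
  finally show ?thesis
    unfolding pay_term_def r_def[symmetric] F_def[symmetric] by (simp add: right_diff_distrib)
qed

lemma welfare_maximizers_nonempty:
  fixes V :: "'n::finite set_valuation"
  shows "welfare_maximizers V b \<noteq> {}"
proof -
  let ?W = "\<lambda>\<sigma>. welfare V (perm_alloc \<sigma>) b"
  have "finite {\<sigma>. \<sigma> permutes (UNIV :: 'n set)}"
    by (rule finite_permutations) simp
  moreover have "{\<sigma>. \<sigma> permutes (UNIV :: 'n set)} \<noteq> {}"
    using permutes_id by blast
  ultimately obtain \<sigma> where "\<sigma> permutes UNIV" "\<And>\<tau>. \<tau> permutes UNIV \<Longrightarrow> ?W \<tau> \<le> ?W \<sigma>"
    using obtains_MAX[of "{\<sigma>. \<sigma> permutes UNIV}" ?W]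
    by (metis (no_types, lifting) Max_ge finite_imageI imageI mem_Collect_eq)
  then show ?thesis
    unfolding welfare_maximizers_def by blast
qed

theorem theorem4p6:
  fixes w f :: "'n::finite \<Rightarrow> real \<Rightarrow> real"
    and v :: "'n good_valuation"
    and V :: "'n set_valuation"
    and Sig :: "'n \<Rightarrow> 'n \<Rightarrow> real set"
  assumes "\<And>i x. w i differentiable (at x)"
    and "\<And>i x. f i differentiable (at x)"
    and "\<And>i. strict_mono (w i)"
    and "\<And>i S s. S \<noteq> {} \<Longrightarrow> V i S s = Max ((\<lambda>K. v i K (column K s)) ` S)"
    and "\<And>i K y. v i K y = w i (y $ i) + (\<Sum>j\<in>UNIV - {i}. f j (y $ j))"
    and "\<And>i x. deriv (w i) x > deriv (f i) x"
    and "\<And>i. \<exists>c d. \<forall>x. w i x = c * f i x + d"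
  shows "nash_equilibrium (auction1_utility w f v V)
           {s. (\<forall>i K. s $ i $ K \<in> Sig i K) \<and> (\<forall>i K. v i K (column K s) \<ge> 0)}
           truthful"
proof -
  note w_mono = assms(3) and v = assms(5)
  have V: "V i {K} s = v i K (column K s)" for i K s
    using assms(4) by simp
  have "auction1_utility w f v V s (\<chi> j. if j = i then x else s $ j) i \<le> auction1_utility w f v V s s i"
    for s :: "'n profile" and i x
  proof -
    define b :: "'n profile" where "b = (\<chi> j. if j = i then x else s $ j)"
    define r where "r = deriv (w i) 0 / (deriv (w i) 0 - deriv (f i) 0)"
    \<comment> \<open>\<open>C\<close> is built from the true profile \<open>s\<close> only, so the
      bid \<open>x\<close> cannot influence it.\<close>
    define C where
      "C = r * (\<Sum>K\<in>UNIV. f i (s $ i $ K)) + Max (pay_term w f v V s i ` {\<tau>. \<tau> permutes UNIV})"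
    define U where "U = (\<lambda>\<sigma>. r * welfare V (perm_alloc \<sigma>) s - C)"
    have others: "b $ j = s $ j" if "j \<noteq> i" for j
      using that by (simp add: b_def)
    obtain c d where affine: "\<And>x. w i x = c * f i x + d"
      using assms(7) by blast
    have "r > 0" and "\<exists>e. \<forall>x. r * (w i x - f i x) = w i x + e"
      unfolding r_def using affine_deriv_ratio[OF assms(2) w_mono assms(6) affine] by blast+
    then obtain e where ratio: "\<And>x. r * (w i x - f i x) = w i x + e"
      by blast
    have pay: "pay_term w f v V t i \<sigma> = pay_term w f v V s i \<sigma>"
      if "t = b \<or> t = s" "\<sigma> permutes UNIV" for t \<sigma>
      using that pay_term_own_row_irrelevant[of V v w f i b s e, OF V v others ratio[unfolded r_def]]
      by blast
    have utility: "V i (perm_alloc \<sigma> i) s - payment w f v V t i \<sigma> = U \<sigma>"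
      if t: "t = b \<or> t = s" and \<sigma>: "\<sigma> permutes UNIV" for t \<sigma>
    proof -
      \<comment> \<open>The maximum in the payment is thus the same for both bids. The remaining
        \<open>pay_term\<close>, now taken at \<open>s\<close>, contains the true valuation of the
        received good negatively, so the two cancel.\<close>
      have "pay_term w f v V t i ` {\<tau>. \<tau> permutes UNIV} = pay_term w f v V s i ` {\<tau>. \<tau> permutes UNIV}"
        using pay[OF t] by (auto intro!: image_cong)
      then show ?thesis
        unfolding payment_def pay[OF t \<sigma>] U_def C_def
        by (simp add: pay_term_def perm_alloc_def V r_def)
    qed
    have exp_utility: "auction1_utility w f v V s t i =
        measure_pmf.expectation (pmf_of_set (welfare_maximizers V t)) U" if t: "t = b \<or> t = s" for t
    proof -
      \<comment> \<open>The integrands need to agree only on the support, which consists of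
        permutations.\<close>
      have "set_pmf (pmf_of_set (welfare_maximizers V t)) = welfare_maximizers V t"
        by (intro set_pmf_of_set welfare_maximizers_nonempty finite)
      then show ?thesis
        unfolding auction1_utility_def
        using utility[OF t] by (intro integral_cong_AE) (auto simp: AE_measure_pmf_iff welfare_maximizers_def)
    qed
    obtain \<tau> where \<tau>: "\<tau> \<in> welfare_maximizers V s"
      using welfare_maximizers_nonempty by blast
    have U_le: "U \<sigma> \<le> U \<tau>" if "\<sigma> permutes UNIV" for \<sigma>
      using \<tau> that \<open>r > 0\<close> by (simp add: U_def welfare_maximizers_def)
    have integrable: "integrable (measure_pmf (pmf_of_set (welfare_maximizers V t))) U" for t
      by (rule integrable_measure_pmf_finite) simp
    have max_permutes: "\<sigma> permutes UNIV"
      if "\<sigma> \<in> set_pmf (pmf_of_set (welfare_maximizers V t))" for \<sigma> t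
      using that set_pmf_of_set[OF welfare_maximizers_nonempty finite]
      by (auto simp: welfare_maximizers_def)
    \<comment> \<open>Both bids now yield lotteries over the same function \<open>U\<close>: a
      deviation mixes permutations worth at most \<open>U \<tau>\<close>, while truth mixes only
      maximizers, each worth at least \<open>U \<tau>\<close>.\<close>
    have "measure_pmf.expectation (pmf_of_set (welfare_maximizers V b)) U \<le> U \<tau>"
      by (intro measure_pmf.integral_le_const integrable) (auto simp: AE_measure_pmf_iff intro: U_le max_permutes)
    also have "\<dots> \<le> measure_pmf.expectation (pmf_of_set (welfare_maximizers V s)) U"
    proof (intro measure_pmf.integral_ge_const integrable)
      have "U \<tau> \<le> U \<sigma>" if "\<sigma> \<in> welfare_maximizers V s" for \<sigma>
        using \<tau> that \<open>r > 0\<close> by (simp add: U_def welfare_maximizers_def)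
      then show "AE \<sigma> in measure_pmf (pmf_of_set (welfare_maximizers V s)). U \<tau> \<le> U \<sigma>"
        using set_pmf_of_set[OF welfare_maximizers_nonempty finite] by (auto simp: AE_measure_pmf_iff)
    qed
    finally show ?thesis
      using exp_utility by (simp add: b_def)
  qed
  then show ?thesis
    unfolding nash_equilibrium_def truthful_def by simp
qed

end
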